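(* Let $t\geq 2$ and $k=2t+1$. Then every isolation set of $A_{k,t}$ has size at most $5$.
   Context: $[k]=\{1,\dots,k\}$ and $A_{k,t}$ is the Boolean matrix with rows and columns indexed by all $t$-subsets of $[k]$, with entry $1$ at $(x,y)$ iff $x\cap y\neq\emptyset$. An isolation set of a Boolean matrix $B$ is a set $F$ of entries of $B$ all equal to $1$, such that no two entries of $F$ lie in the same row or column, and no two entries of $F$ lie in a common $2\times 2$ all-ones submatrix of $B$ (i.e., for distinct entries $(i,j),(i',j')\in F$, $B[i][j']=0$ or $B[i'][j]=0$). *)

theory Defs
  imports Main "HOL-Library.Ramsey"
begin

text \<open>Only the values of the entries at row and column indices in
  \<open>rows\<close> and \<open>cols\<close> are meaningful.\<close>

record ('r, 'c) bool_matrix =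
  rows :: "'r set"
  cols :: "'c set"
  entry :: "'r \<Rightarrow> 'c \<Rightarrow> bool"

definition isolation_set :: "('r, 'c) bool_matrix \<Rightarrow> ('r \<times> 'c) set \<Rightarrow> bool" where
  "isolation_set B F \<longleftrightarrow>
     F \<subseteq> rows B \<times> cols B \<and>
     (\<forall>(i, j) \<in> F. entry B i j) \<and>
     (\<forall>(i, j) \<in> F. \<forall>(i', j') \<in> F. (i, j) \<noteq> (i', j') \<longrightarrow>
        i \<noteq> i' \<and> j \<noteq> j' \<and> (\<not> entry B i j' \<or> \<not> entry B i' j))"

text \<open>\<open>nsets {1..k} t\<close> is the set of all \<open>t\<close>-subsets of \<open>{1, \<dots>, k}\<close>.\<close>

definition intersection_matrix :: "nat \<Rightarrow> nat \<Rightarrow> (nat set, nat set) bool_matrix" where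
  "intersection_matrix k t =
     \<lparr>rows = nsets {1..k} t, cols = nsets {1..k} t, entry = (\<lambda>x y. x \<inter> y \<noteq> {})\<rparr>"

end

theory Submission
  imports Defs
begin

text \<open>
  Suppose there are six entries \<open>(x, y)\<close>. Replacing \<open>y\<close> by its complement \<open>z\<close> turns disjointness
  of \<open>x\<close> and \<open>y\<close> into \<open>x \<subseteq> z\<close>, where \<open>x\<close> has \<open>t\<close> and \<open>z\<close> has \<open>t + 1\<close> elements. Isolation gives at
  least 15 incidences \<open>x \<subseteq> z\<close>, and no \<open>z\<close> lies above its own \<open>x\<close>.

  Two different \<open>x\<close> below a common \<open>z\<close> have union \<open>z\<close>, so each of the 15 pairs of lower sets is
  covered by at most one \<open>z\<close>; let \<open>m\<close> be the number of uncovered pairs and \<open>d\<close> the degree of \<open>z\<close>.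
  Then the \<open>d choose 2\<close> and \<open>m\<close> add up to 15. A lower set not below \<open>z\<close> forms covered pairs with
  at most two of the sets below \<open>z\<close>, hence \<open>m \<ge> (6 - d) * (d - 2)\<close>. Together these force
  \<open>m = 3\<close>, all degrees 2 or 3, and some upper set \<open>c\<close> of degree 3. The three lower sets outside
  \<open>c\<close> are then pairwise covered, and each has a single point outside \<open>c\<close>. If their traces on \<open>c\<close>
  agree, then one finds seven upper sets. Otherwise they share the same outer point \<open>p\<close>, everything
  lies in \<open>c \<union> {p}\<close>, each lower set has at most two upper sets there, and there are at most 12
  incidences.
\<close>

text \<open>\<open>U\<close> holds the row sets and \<open>Z\<close> the complements of the column
  sets. The pairing between them is forgotten: \<open>not_all_below\<close> is what remains of the
  diagonal entries being 1.\<close>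

locale six_by_six =
  fixes U Z :: "'a set set" and t :: nat
  assumes card_U: "card U = 6" and card_Z: "card Z = 6"
    and finite_lower: "x \<in> U \<Longrightarrow> finite x" and card_lower: "x \<in> U \<Longrightarrow> card x = t"
    and finite_upper: "z \<in> Z \<Longrightarrow> finite z" and card_upper: "z \<in> Z \<Longrightarrow> card z = Suc t"
    and not_all_below: "z \<in> Z \<Longrightarrow> \<exists>x\<in>U. \<not> x \<subseteq> z"
begin

section \<open>Covered and missing pairs of lower sets\<close>

definition below :: "'a set \<Rightarrow> 'a set set" where
  "below z = {x \<in> U. x \<subseteq> z}"

definition covered :: "'a set set set" where
  "covered = (\<Union>z\<in>Z. {p. p \<subseteq> below z \<and> card p = 2})"

definition missing :: "'a set set set" where
  "missing = {p. p \<subseteq> U \<and> card p = 2} - covered"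

lemma finite_U: "finite U" and finite_Z: "finite Z"
  using card_U card_Z by (auto intro: card_ge_0_finite)

lemma finite_below: "finite (below z)"
  unfolding below_def using finite_U by simp

lemma below_subset: "below z \<subseteq> U"
  unfolding below_def by auto

text \<open>Two distinct \<open>t\<close>-sets have a union of more than \<open>t\<close> elements,
  which fills the \<open>(t + 1)\<close>-set \<open>z\<close>. So a covered pair determines the
  \<open>z\<close> that covers it.\<close>

lemma Un_eq_upper:
  assumes "x \<in> below z" "x' \<in> below z" "x \<noteq> x'" "z \<in> Z"
  shows "x \<union> x' = z"
proof -
  have U: "x \<in> U" "x' \<in> U" and sub: "x \<union> x' \<subseteq> z"
    using assms by (auto simp: below_def)
  have "\<not> x' \<subseteq> x"
    using card_subset_eq[OF finite_lower[OF U(1)], of x'] U card_lower assms(3) by auto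
  then have "x \<subset> x \<union> x'" by auto
  then have "t < card (x \<union> x')"
    using psubset_card_mono[of "x \<union> x'" x] U finite_lower card_lower by auto
  then show ?thesis
    using sub card_upper[OF assms(4)] finite_upper[OF assms(4)] by (intro card_seteq) auto
qed

lemma Suc_card_Int:
  assumes "x \<in> below z" "x' \<in> below z" "x \<noteq> x'" "z \<in> Z"
  shows "Suc (card (x \<inter> x')) = t"
proof -
  have U: "x \<in> U" "x' \<in> U" using assms by (auto simp: below_def)
  have "card x + card x' = card (x \<union> x') + card (x \<inter> x')"
    using U finite_lower by (intro card_Un_Int) auto
  then show ?thesis
    using Un_eq_upper[OF assms] card_upper[OF assms(4)] U card_lower by simp
qed

lemma coveredE:
  assumes "{x, x'} \<in> covered" "x \<noteq> x'"
  obtains z where "z \<in> Z" "x \<in> below z" "x' \<in> below z" "x \<union> x' = z"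
proof -
  obtain z where "z \<in> Z" "{x, x'} \<subseteq> below z"
    using assms(1) unfolding covered_def by auto
  then show ?thesis using that[of z] Un_eq_upper[of x z x'] assms(2) by simp
qed

lemma covered_Un: "{x, x'} \<in> covered \<Longrightarrow> x \<noteq> x' \<Longrightarrow> x \<union> x' \<in> Z"
  by (metis coveredE)

lemma covered_Int: "{x, x'} \<in> covered \<Longrightarrow> x \<noteq> x' \<Longrightarrow> Suc (card (x \<inter> x')) = t"
  by (metis coveredE Suc_card_Int)

lemma card_covered: "card covered = (\<Sum>z\<in>Z. card (below z) choose 2)"
proof -
  have "card covered = (\<Sum>z\<in>Z. card {p. p \<subseteq> below z \<and> card p = 2})"
    unfolding covered_def
  proof (rule card_UN_disjoint)
    show "\<forall>z\<in>Z. \<forall>w\<in>Z. z \<noteq> w \<longrightarrow>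
        {p. p \<subseteq> below z \<and> card p = 2} \<inter> {p. p \<subseteq> below w \<and> card p = 2} = {}"
    proof (intro ballI impI, rule ccontr)
      fix z w assume zw: "z \<in> Z" "w \<in> Z" "z \<noteq> w"
        and "{p. p \<subseteq> below z \<and> card p = 2} \<inter> {p. p \<subseteq> below w \<and> card p = 2} \<noteq> {}"
      then obtain p where "p \<subseteq> below z" "p \<subseteq> below w" "card p = 2" by auto
      then obtain x x' where "x \<noteq> x'" "{x, x'} \<subseteq> below z" "{x, x'} \<subseteq> below w"
        by (auto simp: card_2_iff)
      then show False using Un_eq_upper[of x z x'] Un_eq_upper[of x w x'] zw by auto
    qed
  qed (use finite_Z finite_below in auto)
  also have "\<dots> = (\<Sum>z\<in>Z. card (below z) choose 2)"
    by (simp add: n_subsets finite_below)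
  finally show ?thesis .
qed

lemma card_missing: "(\<Sum>z\<in>Z. card (below z) choose 2) + card missing = 15"
proof -
  have sub: "covered \<subseteq> {p. p \<subseteq> U \<and> card p = 2}"
    unfolding covered_def using below_subset by blast
  have fin: "finite {p. p \<subseteq> U \<and> card p = 2}"
    using finite_U by simp
  have 1: "card missing = card {p. p \<subseteq> U \<and> card p = 2} - card covered"
    unfolding missing_def using sub fin finite_subset by (intro card_Diff_subset) auto
  have 2: "card covered \<le> card {p. p \<subseteq> U \<and> card p = 2}"
    using sub fin by (rule card_mono[rotated])
  have "card {p. p \<subseteq> U \<and> card p = 2} = 15"
    by (simp add: n_subsets finite_U card_U choose_two)
  then show ?thesis using 1 2 card_covered by simp
qed

section \<open>Missing pairs forced by one upper set\<close>

lemma finite_missing: "finite missing"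
  unfolding missing_def using finite_U by simp

text \<open>\<open>x \<inter> x'\<close> has \<open>t - 1\<close> elements and lies in
  \<open>x \<inter> z\<close>, which is a proper part of \<open>x\<close>; so the two are equal. The
  trace \<open>x \<inter> z\<close> thus lies in every covered partner of \<open>x\<close> below
  \<open>z\<close>.\<close>

lemma Int_upper:
  assumes "z \<in> Z" "x \<in> U - below z" "x' \<in> below z" "{x, x'} \<in> covered"
  shows "x \<inter> z \<subseteq> x'" "Suc (card (x \<inter> z)) = t"
proof -
  have ne: "x \<noteq> x'" and x: "x \<in> U" "\<not> x \<subseteq> z" and x': "x' \<subseteq> z"
    using assms by (auto simp: below_def)
  have fx: "finite x" and cx: "card x = t" using x finite_lower card_lower by auto
  have "x \<inter> z \<subset> x" using x by auto
  then have "card (x \<inter> z) < t" using psubset_card_mono[OF fx] cx by blast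
  moreover have "Suc (card (x \<inter> x')) = t" using covered_Int assms(4) ne by blast
  moreover have sub: "x \<inter> x' \<subseteq> x \<inter> z" using x' by auto
  ultimately have "x \<inter> x' = x \<inter> z"
    using fx card_mono[OF _ sub] by (intro card_subset_eq) auto
  then show "x \<inter> z \<subseteq> x'" "Suc (card (x \<inter> z)) = t"
    using \<open>Suc (card (x \<inter> x')) = t\<close> by auto
qed

text \<open>Such an \<open>x\<close> is \<open>R\<close> plus one of the two points of
  \<open>z - R\<close>.\<close>

lemma card_between:
  assumes "z \<in> Z" "R \<subseteq> z" "Suc (card R) = t"
  shows "card {x \<in> below z. R \<subseteq> x} \<le> 2"
proof -
  have fz: "finite z" and fR: "finite R"
    using finite_upper assms finite_subset by blast+
  have "{x \<in> below z. R \<subseteq> x} \<subseteq> (\<lambda>r. insert r R) ` (z - R)"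
  proof
    fix x assume "x \<in> {x \<in> below z. R \<subseteq> x}"
    then have x: "x \<in> U" "x \<subseteq> z" and sub: "R \<subseteq> x" by (auto simp: below_def)
    have "card (x - R) = 1"
      using card_Diff_subset[OF fR sub] assms(3) card_lower[OF x(1)] by auto
    then obtain r where "x - R = {r}" by (auto simp: card_1_singleton_iff)
    then have "x = insert r R" "r \<in> z - R" using sub x by auto
    then show "x \<in> (\<lambda>r. insert r R) ` (z - R)" by blast
  qed
  then have "card {x \<in> below z. R \<subseteq> x} \<le> card (z - R)"
    using fz surj_card_le by blast
  also have "\<dots> = 2"
    using card_Diff_subset[OF fR assms(2)] assms(3) card_upper[OF assms(1)] by auto
  finally show ?thesis .
qed

lemma card_covered_neighbours:
  assumes "z \<in> Z" "x \<in> U - below z"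
  shows "card {x' \<in> below z. {x, x'} \<in> covered} \<le> 2"
proof (cases "{x' \<in> below z. {x, x'} \<in> covered} = {}")
  case True
  then show ?thesis by (metis card.empty zero_le)
next
  case False
  then have "Suc (card (x \<inter> z)) = t" using Int_upper assms by blast
  then have "card {x' \<in> below z. x \<inter> z \<subseteq> x'} \<le> 2"
    using card_between[OF assms(1), of "x \<inter> z"] by simp
  moreover have "card {x' \<in> below z. {x, x'} \<in> covered} \<le> card {x' \<in> below z. x \<inter> z \<subseteq> x'}"
    using Int_upper assms finite_below by (intro card_mono) auto
  ultimately show ?thesis by linarith
qed

text \<open>The pairs are ordered, outer set first, so that they can be counted one outer set at a
  time; forgetting the order is still injective.\<close>

definition missing_from :: "'a set \<Rightarrow> ('a set \<times> 'a set) set" where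
  "missing_from z = (SIGMA x : U - below z. {x' \<in> below z. {x, x'} \<in> missing})"

lemma card_covered_missing:
  assumes "z \<in> Z" "x \<in> U - below z"
  shows "card {x' \<in> below z. {x, x'} \<in> covered} + card {x' \<in> below z. {x, x'} \<in> missing}
    = card (below z)"
proof -
  have "below z = {x' \<in> below z. {x, x'} \<in> covered} \<union> {x' \<in> below z. {x, x'} \<in> missing}"
    using assms below_subset by (auto simp: missing_def card_2_iff)
  moreover have "{x' \<in> below z. {x, x'} \<in> covered} \<inter> {x' \<in> below z. {x, x'} \<in> missing} = {}"
    by (auto simp: missing_def)
  ultimately show ?thesis
    using card_Un_disjoint[of "{x' \<in> below z. {x, x'} \<in> covered}" "{x' \<in> below z. {x, x'} \<in> missing}"]
      finite_below[of z] by auto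
qed

lemma card_missing_from:
  "card (missing_from z) = (\<Sum>x\<in>U - below z. card {x' \<in> below z. {x, x'} \<in> missing})"
  unfolding missing_from_def using finite_U finite_below by (intro card_SigmaI) auto

lemma card_image_missing_from:
  "card ((\<lambda>(x, x'). {x, x'}) ` missing_from z) = card (missing_from z)"
  by (intro card_image inj_onI) (auto simp: missing_from_def doubleton_eq_iff)

lemma image_missing_from: "(\<lambda>(x, x'). {x, x'}) ` missing_from z \<subseteq> missing"
  by (auto simp: missing_from_def)

lemma card_U_Diff_below: "card (U - below z) = 6 - card (below z)"
  using card_Diff_subset[OF finite_below below_subset] card_U by simp

text \<open>Each of the \<open>6 - d\<close> lower sets outside \<open>z\<close> has at most two
  covered partners among the \<open>d\<close> below \<open>z\<close>. For \<open>d < 2\<close> the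
  truncated difference makes the bound trivial.\<close>

lemma card_missing_ge:
  assumes "z \<in> Z"
  shows "(6 - card (below z)) * (card (below z) - 2) \<le> card missing"
proof -
  have "(6 - card (below z)) * (card (below z) - 2) = (\<Sum>x\<in>U - below z. card (below z) - 2)"
    by (simp add: card_U_Diff_below)
  also have "\<dots> \<le> card (missing_from z)"
    unfolding card_missing_from
  proof (rule sum_mono)
    fix x assume "x \<in> U - below z"
    from card_covered_missing[OF assms this] card_covered_neighbours[OF assms this]
    show "card (below z) - 2 \<le> card {x' \<in> below z. {x, x'} \<in> missing}" by linarith
  qed
  also have "\<dots> \<le> card missing"
    using card_mono[OF finite_missing image_missing_from] card_image_missing_from by metis
  finally show ?thesis .
qed

section \<open>Degrees of the upper sets\<close>

lemma card_below_less: "z \<in> Z \<Longrightarrow> card (below z) < 6"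
  using psubset_card_mono[OF finite_U, of "below z"] not_all_below[of z] below_subset[of z] card_U
  by (auto simp: below_def)

text \<open>The inequality \<open>d choose 2 + 3 \<ge> 2 * d\<close> is an equality exactly for \<open>d \<in> {2, 3}\<close>.\<close>

lemma degrees:
  assumes "15 \<le> (\<Sum>z\<in>Z. card (below z))"
  shows "card missing = 3" "z \<in> Z \<Longrightarrow> card (below z) \<in> {2, 3}" "\<exists>z\<in>Z. card (below z) = 3"
proof -
  \<comment> \<open>Integers are used because truncated subtraction would make nonnegativity of
    \<open>g\<close> empty.\<close>
  define g :: "nat \<Rightarrow> int" where "g d = int (d choose 2) + 3 - 2 * int d" for d
  have small: "g d \<ge> 0 \<and> (g d = 0 \<longrightarrow> d \<in> {2, 3})" if "d < 6" for d
  proof -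
    have "d \<in> {0, 1, 2, 3, 4, 5}" using that by auto
    then show ?thesis by (auto simp: g_def choose_two)
  qed
  have nonneg: "g (card (below z)) \<ge> 0" if "z \<in> Z" for z
    using small card_below_less that by blast
  have "\<exists>z\<in>Z. 3 \<le> card (below z)"
  proof (rule ccontr)
    assume "\<not> ?thesis"
    then have "(\<Sum>z\<in>Z. card (below z)) \<le> (\<Sum>z\<in>Z. 2)" by (intro sum_mono) auto
    then show False using assms card_Z by simp
  qed
  then obtain z0 where z0: "z0 \<in> Z" "3 \<le> card (below z0)" by blast
  have m3: "3 \<le> card missing"
  proof -
    \<comment> \<open>Degree 6, for which \<open>card_missing_ge\<close> gives only 0, is excluded;
      degrees 3, 4, 5 give the bounds 3, 4, 3.\<close>
    have "card (below z0) \<in> {3, 4, 5}" using z0 card_below_less[of z0] by auto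
    then show ?thesis using card_missing_ge[OF z0(1)] by auto
  qed
  have sum_g: "(\<Sum>z\<in>Z. g (card (below z)))
      = int (\<Sum>z\<in>Z. card (below z) choose 2) + 18 - 2 * int (\<Sum>z\<in>Z. card (below z))"
    by (simp add: g_def sum.distrib sum_subtractf card_Z sum_distrib_left)
  \<comment> \<open>By \<open>card_missing\<close> and the 15 incidences the sum is at most
    \<open>(15 - m) + 18 - 30 = 3 - m\<close>, where \<open>m = card missing\<close> is at least 3.
    So both bounds are tight.\<close>
  have "(\<Sum>z\<in>Z. g (card (below z))) \<ge> 0" using nonneg by (intro sum_nonneg) auto
  then have m: "card missing = 3" and g0: "(\<Sum>z\<in>Z. g (card (below z))) = 0"
    using sum_g card_missing m3 assms by linarith+
  have all: "card (below z) \<in> {2, 3}" if "z \<in> Z" for z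
  proof -
    have "g (card (below z)) = 0"
      using g0 sum_nonneg_eq_0_iff[OF finite_Z, of "\<lambda>z. g (card (below z))"] nonneg that by auto
    then show ?thesis using small card_below_less that by blast
  qed
  show "card missing = 3" by (fact m)
  show "z \<in> Z \<Longrightarrow> card (below z) \<in> {2, 3}" by (fact all)
  show "\<exists>z\<in>Z. card (below z) = 3" using z0 all by fastforce
qed

section \<open>Lower sets outside an upper set of degree 3\<close>

lemma outside_triple:
  assumes "card missing = 3" "z \<in> Z" "card (below z) = 3"
  shows "x \<in> U - below z \<Longrightarrow> card {x' \<in> below z. {x, x'} \<in> covered} = 2"
    and "x \<in> U - below z \<Longrightarrow> x' \<in> U - below z \<Longrightarrow> x \<noteq> x' \<Longrightarrow> {x, x'} \<in> covered"
proof -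
  let ?m = "\<lambda>x. card {x' \<in> below z. {x, x'} \<in> missing}"
  have c3: "card (U - below z) = 3" using card_U_Diff_below assms by simp
  have ge: "1 \<le> ?m x" if "x \<in> U - below z" for x
    using card_covered_missing[OF assms(2) that] card_covered_neighbours[OF assms(2) that] assms(3)
    by linarith
  have le: "card (missing_from z) \<le> 3"
    using card_mono[OF finite_missing image_missing_from] card_image_missing_from assms(1) by metis
  \<comment> \<open>Each of the three outer sets uses at least one of the three missing pairs, so
    each uses exactly one. All missing pairs then join an outer set to one below \<open>z\<close>,
    and none is left between two outer sets.\<close>
  have "(\<Sum>x\<in>U - below z. 1) \<le> (\<Sum>x\<in>U - below z. ?m x)" using ge by (intro sum_mono) auto
  then have eq: "card (missing_from z) = 3" using le c3 card_missing_from by simp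
  then have img: "(\<lambda>(x, x'). {x, x'}) ` missing_from z = missing"
    using card_image_missing_from assms(1)
    by (intro card_subset_eq[OF finite_missing image_missing_from]) simp
  have "(\<Sum>x\<in>U - below z. ?m x - 1) = 0"
    using sum_subtractf_nat[of "U - below z" "\<lambda>_. 1" ?m] ge eq c3 card_missing_from by simp
  then have one: "?m x = 1" if "x \<in> U - below z" for x
    using that ge[OF that] finite_U by (simp add: le_antisym)
  show "x \<in> U - below z \<Longrightarrow> card {x' \<in> below z. {x, x'} \<in> covered} = 2"
    using card_covered_missing[OF assms(2)] one assms(3) by fastforce
  show "{x, x'} \<in> covered" if "x \<in> U - below z" "x' \<in> U - below z" "x \<noteq> x'"
  proof (rule ccontr)
    assume "{x, x'} \<notin> covered"
    then have "{x, x'} \<in> missing" using that by (auto simp: missing_def)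
    then have "{x, x'} \<in> (\<lambda>(x, x'). {x, x'}) ` missing_from z" unfolding img .
    then obtain a b where "{x, x'} = {a, b}" "(a, b) \<in> missing_from z" by auto
    then show False using that by (auto simp: missing_from_def doubleton_eq_iff)
  qed
qed

lemma outside_insert:
  assumes "card missing = 3" "z \<in> Z" "card (below z) = 3" "x \<in> U - below z"
  obtains p where "x - z = {p}" "Suc (card (x \<inter> z)) = t"
proof -
  have "{x' \<in> below z. {x, x'} \<in> covered} \<noteq> {}"
    using outside_triple(1)[OF assms] by force
  then have ct: "Suc (card (x \<inter> z)) = t" using Int_upper assms by blast
  have "finite x" "card x = t" using assms finite_lower card_lower by auto
  then have "card (x - z) = 1"
    using card_Diff_subset_Int[of x z] ct by auto
  then obtain p where "x - z = {p}" by (auto simp: card_1_singleton_iff)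
  then show ?thesis using that ct by blast
qed

text \<open>As the outer points differ, \<open>x \<inter> y\<close> lies inside \<open>c\<close>,
  hence in both traces; all three sets have \<open>t - 1\<close> elements.\<close>

lemma covered_Int_eq:
  assumes "{x, y} \<in> covered" "x \<noteq> y" "x - c = {a}" "y - c = {b}" "a \<noteq> b" "finite c"
    and "Suc (card (x \<inter> c)) = t" "Suc (card (y \<inter> c)) = t"
  shows "x \<inter> c = y \<inter> c"
proof -
  have "(x - c) \<inter> (y - c) = {}" using assms(3,4,5) by simp
  then have sub: "x \<inter> y \<subseteq> x \<inter> c" "x \<inter> y \<subseteq> y \<inter> c" by blast+
  have "Suc (card (x \<inter> y)) = t" using covered_Int assms(1,2) by blast
  then have "x \<inter> y = x \<inter> c" "x \<inter> y = y \<inter> c"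
    using sub assms(6-8) by (intro card_subset_eq; simp)+
  then show ?thesis by simp
qed

text \<open>Counted from the lower sets: an upper set above \<open>x\<close> inside \<open>V\<close>
  is \<open>x\<close> plus one of the two points of \<open>V - x\<close>.\<close>

lemma incidences_in_small_set:
  assumes V: "finite V" "card V = t + 2" and sub: "\<And>z. z \<in> Z \<Longrightarrow> z \<subseteq> V"
  shows "(\<Sum>z\<in>Z. card (below z)) \<le> 12"
proof -
  have "(\<Sum>z\<in>Z. card (below z)) = (\<Sum>x\<in>U. card {z \<in> Z. x \<subseteq> z})"
    unfolding below_def
    using finite_Z finite_U by (intro sum_multicount_gen) auto
  also have "\<dots> \<le> (\<Sum>x\<in>U. 2)"
  proof (rule sum_mono)
    fix x assume x: "x \<in> U"
    show "card {z \<in> Z. x \<subseteq> z} \<le> 2"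
    proof (cases "x \<subseteq> V")
      case False
      then have "{z \<in> Z. x \<subseteq> z} = {}" using sub by blast
      then show ?thesis by (metis card.empty zero_le)
    next
      case True
      have "{z \<in> Z. x \<subseteq> z} \<subseteq> (\<lambda>r. insert r x) ` (V - x)"
      proof
        fix z assume "z \<in> {z \<in> Z. x \<subseteq> z}"
        then have z: "z \<in> Z" "x \<subseteq> z" by auto
        have "card (z - x) = 1"
          using card_Diff_subset[OF finite_lower[OF x] z(2)] card_upper[OF z(1)] card_lower[OF x]
          by simp
        then obtain r where "z - x = {r}" by (auto simp: card_1_singleton_iff)
        then have "z = insert r x" "r \<in> V - x" using z sub by auto
        then show "z \<in> (\<lambda>r. insert r x) ` (V - x)" by blast
      qed
      then have "card {z \<in> Z. x \<subseteq> z} \<le> card (V - x)"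
        using V(1) surj_card_le by blast
      also have "\<dots> = 2"
        using card_Diff_subset[OF finite_lower[OF x] True] V card_lower[OF x] by simp
      finally show ?thesis .
    qed
  qed
  finally show ?thesis using card_U by simp
qed

section \<open>Fewer than 15 incidences\<close>

lemma incidences_less: "(\<Sum>z\<in>Z. card (below z)) < 15"
proof (rule ccontr)
  assume "\<not> ?thesis"
  then have 15: "15 \<le> (\<Sum>z\<in>Z. card (below z))" by simp
  note m = degrees(1)[OF 15]
  obtain c where c: "c \<in> Z" "card (below c) = 3" using degrees(3)[OF 15] by blast
  have "card (U - below c) = 3" using card_U_Diff_below c by simp
  then obtain u v w where out: "U - below c = {u, v, w}" and ne: "u \<noteq> v" "u \<noteq> w" "v \<noteq> w"
    by (auto simp: card_3_iff)
  note cov = outside_triple(2)[OF m c, unfolded out]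
  have uin: "u \<in> U - below c" and vin: "v \<in> U - below c" and win: "w \<in> U - below c"
    unfolding out by auto
  obtain p where p: "u - c = {p}" "Suc (card (u \<inter> c)) = t"
    using outside_insert[OF m c uin] .
  obtain q where q: "v - c = {q}" "Suc (card (v \<inter> c)) = t"
    using outside_insert[OF m c vin] .
  obtain r where r: "w - c = {r}" "Suc (card (w \<inter> c)) = t"
    using outside_insert[OF m c win] .
  have fc: "finite c" "card c = Suc t" using finite_upper card_upper c by auto
  show False
  proof (cases "u \<inter> c = v \<inter> c \<and> v \<inter> c = w \<inter> c")
    case True
    then have pqr: "p \<noteq> q" "p \<noteq> r" "q \<noteq> r"
      using p(1) q(1) r(1) ne by (metis Un_Diff_Int)+
    \<comment> \<open>Two covered partners lie among at most two sets containing the common trace,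
      so \<open>u\<close>, \<open>v\<close>, \<open>w\<close> all have the same two partners, named
      \<open>b\<close> and \<open>d\<close> below.\<close>
    have same_covered: "{x' \<in> below c. {x, x'} \<in> covered} = {x' \<in> below c. u \<inter> c \<subseteq> x'}"
      if "x \<in> {u, v, w}" for x
    proof (rule card_seteq)
      have x: "x \<in> U - below c" "x \<inter> c = u \<inter> c" using that True out by auto
      show "{x' \<in> below c. {x, x'} \<in> covered} \<subseteq> {x' \<in> below c. u \<inter> c \<subseteq> x'}"
        using Int_upper[OF c(1) x(1)] x(2) by blast
      show "card {x' \<in> below c. u \<inter> c \<subseteq> x'} \<le> card {x' \<in> below c. {x, x'} \<in> covered}"
        using outside_triple(1)[OF m c x(1)] card_between[OF c(1) _ p(2)] by simp
    qed (use finite_below in simp)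
    let ?B = "{x' \<in> below c. u \<inter> c \<subseteq> x'}"
    have "card ?B = 2"
      using outside_triple(1)[OF m c uin] same_covered[of u] by simp
    then obtain b d where B: "?B = {b, d}" and bd: "b \<noteq> d"
      by (auto simp: card_2_iff)
    then have bdc: "b \<subseteq> c" "d \<subseteq> c" by (auto simp: below_def)
    have in_Z: "x \<union> x' \<in> Z" if "x \<in> {u, v, w}" "x' \<in> {b, d}" for x x'
    proof (rule covered_Un)
      have x': "x' \<in> ?B" using that(2) unfolding B by simp
      then show "{x, x'} \<in> covered" using same_covered[OF that(1)] by auto
      have "x \<in> U - below c" using that(1) unfolding out by simp
      then show "x \<noteq> x'" using x' by auto
    qed
    \<comment> \<open>The part of \<open>y\<close> inside \<open>c\<close> is already in
      \<open>x'\<close>, so \<open>y \<union> x'\<close> only adds the outer point of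
      \<open>y\<close>.\<close>
    have un: "insert a x' \<in> Z" if "y - c = {a}" "y \<in> {u, v, w}" "x' \<in> {b, d}" for a y x'
    proof -
      have "x' \<in> ?B" using that(3) unfolding B by simp
      then have "y \<inter> c \<subseteq> x'" using that(2) True by auto
      then have "y \<union> x' = (y - c) \<union> x'" by blast
      then show ?thesis using in_Z[OF that(2,3)] that(1) by simp
    qed
    have pqr_c: "p \<notin> c" "q \<notin> c" "r \<notin> c" using p(1) q(1) r(1) by auto
    let ?f = "\<lambda>(a, x). insert a x"
    \<comment> \<open>Outside \<open>c\<close> one reads off the added point, inside
      \<open>c\<close> the set \<open>b\<close> or \<open>d\<close>. The six upper sets so obtained
      differ from \<open>c\<close>, which is the seventh.\<close>
    have "inj_on ?f ({p, q, r} \<times> {b, d})"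
    proof (rule inj_on_inverseI)
      fix ax assume "ax \<in> {p, q, r} \<times> {b, d}"
      then have "insert (fst ax) (snd ax) - c = {fst ax}" "insert (fst ax) (snd ax) \<inter> c = snd ax"
        using pqr_c bdc by auto
      then show "(\<lambda>z. (the_elem (z - c), z \<inter> c)) (?f ax) = ax"
        by (simp add: case_prod_unfold)
    qed
    then have "card (?f ` ({p, q, r} \<times> {b, d})) = 6"
      using pqr bd by (simp add: card_image card_cartesian_product)
    moreover have "c \<notin> ?f ` ({p, q, r} \<times> {b, d})" using pqr_c by auto
    ultimately have seven: "card (insert c (?f ` ({p, q, r} \<times> {b, d}))) = 7" by simp
    have "insert c (?f ` ({p, q, r} \<times> {b, d})) \<subseteq> Z"
      using un[OF p(1)] un[OF q(1)] un[OF r(1)] c(1) by auto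
    from card_mono[OF finite_Z this] seven card_Z show False by linarith
  next
    case False
    \<comment> \<open>Different outer points force equal traces. If two outer points differed, the
      third set, having another trace, would share its outer point with both.\<close>
    have pqr: "q = p" "r = p"
    proof -
      have "p = q \<or> u \<inter> c = v \<inter> c"
        using covered_Int_eq[OF cov ne(1) p(1) q(1) _ fc(1) p(2) q(2)] ne by auto
      moreover have "p = r \<or> u \<inter> c = w \<inter> c"
        using covered_Int_eq[OF cov ne(2) p(1) r(1) _ fc(1) p(2) r(2)] ne by auto
      moreover have "q = r \<or> v \<inter> c = w \<inter> c"
        using covered_Int_eq[OF cov ne(3) q(1) r(1) _ fc(1) q(2) r(2)] ne by auto
      ultimately show "q = p" "r = p" using False by metis+
    qed
    have lower: "x \<subseteq> insert p c" if "x \<in> U" for x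
    proof (cases "x \<in> below c")
      case True
      then show ?thesis by (auto simp: below_def)
    next
      case False
      then have "x \<in> {u, v, w}" using that out by auto
      then have "x - c = {p}" using p(1) q(1) r(1) pqr by auto
      then show ?thesis by auto
    qed
    \<comment> \<open>Having degree at least 2, \<open>z\<close> is a union of two lower
      sets.\<close>
    have "z \<subseteq> insert p c" if z: "z \<in> Z" for z
    proof -
      have "card (below z) \<ge> 2" using degrees(2)[OF 15 z] by auto
      then obtain x y where xy: "x \<in> below z" "y \<in> below z" "x \<noteq> y"
        by (metis card_le_Suc0_iff_eq finite_below not_less_eq_eq numeral_2_eq_2)
      then have "x \<subseteq> insert p c" "y \<subseteq> insert p c"
        using lower below_subset by blast+
      then show ?thesis using Un_eq_upper[OF xy z] by auto
    qed
    moreover have "p \<notin> c" using p(1) by auto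
    ultimately have "(\<Sum>z\<in>Z. card (below z)) \<le> 12"
      using fc by (intro incidences_in_small_set[of "insert p c"]) auto
    then show False using 15 by simp
  qed
qed

end

section \<open>From isolation sets to inclusions\<close>

theorem theorem4:
  fixes t k :: nat and F :: "(nat set \<times> nat set) set"
  assumes "t \<ge> 2" and "k = 2 * t + 1"
    and "isolation_set (intersection_matrix k t) F"
  shows "card F \<le> 5"
proof (rule ccontr)
  assume "\<not> card F \<le> 5"
  then have "6 \<le> card F" by simp
  then obtain G where G: "G \<subseteq> F" "card G = 6" "finite G"
    by (rule obtain_subset_with_card_n)
  have F: "F \<subseteq> nsets {1..k} t \<times> nsets {1..k} t" "\<forall>(x, y) \<in> F. x \<inter> y \<noteq> {}"
    "\<forall>(x, y) \<in> F. \<forall>(x', y') \<in> F. (x, y) \<noteq> (x', y') \<longrightarrow>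
      x \<noteq> x' \<and> y \<noteq> y' \<and> (x \<inter> y' = {} \<or> x' \<inter> y = {})"
    using assms(3) by (simp_all add: isolation_set_def intersection_matrix_def)
  have mem: "finite (fst a)" "card (fst a) = t" "fst a \<subseteq> {1..k}"
      "card (snd a) = t" "snd a \<subseteq> {1..k}" "fst a \<inter> snd a \<noteq> {}"
    if "a \<in> G" for a
  proof -
    have a: "a \<in> F" using that G(1) by blast
    then have "a \<in> nsets {1..k} t \<times> nsets {1..k} t" using F(1) by blast
    then show "finite (fst a)" "card (fst a) = t" "fst a \<subseteq> {1..k}"
      "card (snd a) = t" "snd a \<subseteq> {1..k}"
      by (auto simp: nsets_def)
    show "fst a \<inter> snd a \<noteq> {}" using F(2) a by (simp add: case_prod_unfold)
  qed
  have iso: "fst a \<noteq> fst b \<and> snd a \<noteq> snd b \<and> (fst a \<inter> snd b = {} \<or> fst b \<inter> snd a = {})"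
    if "a \<in> G" "b \<in> G" "a \<noteq> b" for a b
  proof -
    have "a \<in> F" "b \<in> F" using that G(1) by blast+
    moreover have "fst a \<noteq> fst b \<or> snd a \<noteq> snd b" using that(3) prod_eqI by blast
    ultimately show ?thesis using F(3) by (simp add: case_prod_unfold) meson
  qed
  let ?upper = "\<lambda>a. {1..k} - snd a"
  have inj: "inj_on fst G" "inj_on ?upper G"
  proof -
    show "inj_on fst G" using iso by (meson inj_onI)
    show "inj_on ?upper G"
    proof (intro inj_onI)
      fix a b assume ab: "a \<in> G" "b \<in> G" "?upper a = ?upper b"
      then have "snd a = snd b" using mem(5) by (metis double_diff order_refl)
      then show "a = b" using iso ab by meson
    qed
  qed
  interpret six_by_six "fst ` G" "?upper ` G" t
  proof
    show "card (fst ` G) = 6" "card (?upper ` G) = 6"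
      using inj G(2) by (simp_all add: card_image)
    show "finite x" "card x = t" if "x \<in> fst ` G" for x
      using that mem(1,2) by auto
    show "finite z" "card z = Suc t" if z: "z \<in> ?upper ` G" for z
    proof -
      obtain a where a: "a \<in> G" "z = {1..k} - snd a" using z by blast
      then show "finite z" by simp
      have "finite (snd a)" using mem(5)[OF a(1)] finite_subset by blast
      \<comment> \<open>This is where \<open>k = 2 * t + 1\<close> enters: the complement has
        \<open>k - t = t + 1\<close> elements.\<close>
      then show "card z = Suc t"
        using mem(4,5)[OF a(1)] a(2) assms(2) by (simp add: card_Diff_subset)
    qed
    show "\<exists>x\<in>fst ` G. \<not> x \<subseteq> z" if z: "z \<in> ?upper ` G" for z
    proof -
      obtain a where a: "a \<in> G" "z = {1..k} - snd a" using z by blast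
      then have "\<not> fst a \<subseteq> z" using mem(6)[OF a(1)] by blast
      then show ?thesis using a(1) by blast
    qed
  qed
  let ?I = "\<lambda>a b. fst a \<inter> snd b = {}"
  let ?S = "{(a, b) \<in> G \<times> G. ?I a b}"
  have card_below: "card (below (?upper b)) = card {a \<in> G. ?I a b}" if "b \<in> G" for b
  proof -
    have "fst a \<subseteq> ?upper b \<longleftrightarrow> ?I a b" if "a \<in> G" for a
      using mem(3)[OF that] by blast
    then have "below (?upper b) = fst ` {a \<in> G. ?I a b}"
      unfolding below_def by auto
    then show ?thesis
      using inj(1) by (simp add: card_image inj_on_subset)
  qed
  \<comment> \<open>Isolation makes every unordered pair of entries disjoint in at least one
    orientation, so \<open>?S\<close> maps onto the 15 pairs.\<close>
  have "card {p. p \<subseteq> G \<and> card p = 2} \<le> card ?S"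
  proof (rule surj_card_le)
    show "finite ?S" using G(3) by (auto intro: finite_subset[of _ "G \<times> G"])
    show "{p. p \<subseteq> G \<and> card p = 2} \<subseteq> (\<lambda>(a, b). {a, b}) ` ?S"
    proof
      fix e assume "e \<in> {p. p \<subseteq> G \<and> card p = 2}"
      then have "e \<subseteq> G" "card e = 2" by auto
      then obtain a b where "e = {a, b}" "a \<noteq> b"
        unfolding card_2_iff by (elim exE conjE)
      with \<open>e \<subseteq> G\<close> have e: "e = {a, b}" "a \<noteq> b" "a \<in> G" "b \<in> G" by simp_all
      have "?I a b \<or> ?I b a" using iso[OF e(3,4,2)] by simp
      then have "(a, b) \<in> ?S \<or> (b, a) \<in> ?S" using e(3,4) by simp
      then show "e \<in> (\<lambda>(a, b). {a, b}) ` ?S"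
      proof
        assume "(a, b) \<in> ?S"
        then show ?thesis by (rule rev_image_eqI) (simp add: e(1))
      next
        assume "(b, a) \<in> ?S"
        then show ?thesis by (rule rev_image_eqI) (simp add: e(1) insert_commute)
      qed
    qed
  qed
  moreover have "card {p. p \<subseteq> G \<and> card p = 2} = 15"
    using G by (simp add: n_subsets choose_two)
  moreover have "card ?S = (\<Sum>b\<in>G. card {a \<in> G. ?I a b})"
  proof -
    have "card ?S = card (SIGMA b : G. {a \<in> G. ?I a b})"
      by (rule bij_betw_same_card[of prod.swap]) (auto simp: bij_betw_def image_iff)
    then show ?thesis using G(3) by simp
  qed
  moreover have "\<dots> = (\<Sum>z\<in>?upper ` G. card (below z))"
    unfolding sum.reindex[OF inj(2)] comp_def using card_below by (intro sum.cong) simp_all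
  ultimately show False using incidences_less by simp
qed

end
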